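(* Let $G$ be a graph with $n$ vertices, $m$ edges and maximum degree $d$. Every $(\geqslant n2^m)$-subdivision of $G$ has stretch-width at most $32(4d+5)^3$.
   Context: For an integer $s$, a $(\geqslant s)$-subdivision of $G$ is any graph obtained from $G$ by subdividing each edge at least $s$ times (i.e., replacing each edge by a path with at least $s$ internal vertices, these paths being internally disjoint). Stretch-width: a partition sequence of an $N$-vertex graph $H$ is a sequence $\mathcal P_N,\dots,\mathcal P_1$ of partitions of $V(H)$ with $\mathcal P_N$ the singleton partition, $\mathcal P_1=\{V(H)\}$, each $\mathcal P_i$ obtained from $\mathcal P_{i+1}$ by merging two parts. Distinct parts $X,Y$ are inhomogeneous if there are $u,u'\in X$, $v,v'\in Y$ with $uv\in E(H)$, $u'v'\notin E(H)$; the red graph $\mathcal R(\mathcal P)$ has vertex set $\mathcal P$ and edges between inhomogeneous parts. For a total order $\prec$ on $V(H)$, the span of $X\subseteq V(H)$ is $\langle X\rangle=\{v:\min X\preceq v\preceq \max X\}$, and $X,Y$ conflict if their spans intersect. For $X\in\mathcal P$, $Y\in\mathcal P\setminus\{X\}$ interferes with $X$ if $Y$ conflicts with the union of the parts in the closed neighborhood of $X$ in $\mathcal R(\mathcal P)$; the stretch of $X$ is the number of parts interfering with it, and the stretch of $\mathcal P$ is the maximum over parts. $\mathrm{stw}(H,\prec)$ is the minimum over partition sequences of the maximum stretch of its partitions; $\mathrm{stw}(H)=\min_\prec\mathrm{stw}(H,\prec)$. *)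

theory Defs
  imports Complex_Main "HOL-Library.Disjoint_Sets"
begin

section \<open>Finite simple graphs\<close>

text \<open>A graph is given by its vertex set and its set of edges, an edge being a
  two-element set of vertices.\<close>

definition simple_graph :: "'a set \<Rightarrow> 'a set set \<Rightarrow> bool" where
  "simple_graph V E \<longleftrightarrow> finite V \<and> (\<forall>e\<in>E. e \<subseteq> V \<and> card e = 2)"

definition vertex_degree :: "'a set set \<Rightarrow> 'a \<Rightarrow> nat" where
  "vertex_degree E v = card {e \<in> E. v \<in> e}"

text \<open>Throughout, maxima of finite sets of natural numbers are written with \<^term>\<open>Sup\<close>,
  which gives the maximum of a nonempty finite set and the value 0 for the empty set.
  The latter only concerns the graph without vertices.\<close>

definition max_degree :: "'a set \<Rightarrow> 'a set set \<Rightarrow> nat" where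
  "max_degree V E = (SUP v\<in>V. vertex_degree E v)"


section \<open>Subdivisions\<close>

definition path_edges :: "'b list \<Rightarrow> 'b set set" where
  "path_edges xs = {{xs ! i, xs ! Suc i} | i. Suc i < length xs}"

definition path_interior :: "'b list \<Rightarrow> 'b set" where
  "path_interior xs = set (butlast (tl xs))"

text \<open>The map \<open>f\<close> embeds the original vertices, and \<open>p e\<close> is the path replacing the edge \<open>e\<close>,
  listed with its two end vertices (in either direction).  The two graphs may have different
  vertex types, so this describes subdivisions up to isomorphism.\<close>

definition is_ge_subdivision ::
    "nat \<Rightarrow> 'a set \<Rightarrow> 'a set set \<Rightarrow> 'b set \<Rightarrow> 'b set set \<Rightarrow> bool" where
  "is_ge_subdivision s V E V' E' \<longleftrightarrow>
     (\<exists>(f :: 'a \<Rightarrow> 'b) (p :: 'a set \<Rightarrow> 'b list).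
        inj_on f V \<and>
        (\<forall>e\<in>E. length (p e) \<ge> s + 2 \<and> distinct (p e) \<and>
               {hd (p e), last (p e)} = f ` e \<and>
               path_interior (p e) \<inter> f ` V = {}) \<and>
        (\<forall>e\<in>E. \<forall>e'\<in>E. e \<noteq> e' \<longrightarrow> path_interior (p e) \<inter> path_interior (p e') = {}) \<and>
        V' = f ` V \<union> (\<Union>e\<in>E. path_interior (p e)) \<and>
        E' = (\<Union>e\<in>E. path_edges (p e)))"


section \<open>Partition sequences and red graphs\<close>

text \<open>\<open>P i\<close> is the partition with \<open>i\<close> parts; only the indices from 1 to \<^term>\<open>card V\<close> matter.\<close>

definition partition_seq :: "'a set \<Rightarrow> (nat \<Rightarrow> 'a set set) \<Rightarrow> bool" where
  "partition_seq V P \<longleftrightarrow>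
     (\<forall>i\<in>{1..card V}. partition_on V (P i)) \<and>
     P (card V) = {{v} | v. v \<in> V} \<and>
     P 1 = {V} \<and>
     (\<forall>i\<in>{1..<card V}. \<exists>X\<in>P (Suc i). \<exists>Y\<in>P (Suc i).
        X \<noteq> Y \<and> P i = insert (X \<union> Y) (P (Suc i) - {X, Y}))"

definition inhomogeneous :: "'a set set \<Rightarrow> 'a set \<Rightarrow> 'a set \<Rightarrow> bool" where
  "inhomogeneous E X Y \<longleftrightarrow> X \<noteq> Y \<and>
     (\<exists>u\<in>X. \<exists>u'\<in>X. \<exists>v\<in>Y. \<exists>v'\<in>Y. {u, v} \<in> E \<and> {u', v'} \<notin> E)"

definition red_edges :: "'a set set \<Rightarrow> 'a set set \<Rightarrow> 'a set set set" where
  "red_edges E P = {{X, Y} | X Y. X \<in> P \<and> Y \<in> P \<and> inhomogeneous E X Y}"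

definition red_closed_nbhd :: "'a set set \<Rightarrow> 'a set set \<Rightarrow> 'a set \<Rightarrow> 'a set set" where
  "red_closed_nbhd E P X = insert X {Y \<in> P. {X, Y} \<in> red_edges E P}"


section \<open>Stretch-width\<close>

text \<open>A total order on \<open>V\<close> is a relation \<open>r\<close> with \<^prop>\<open>linear_order_on V r\<close>, where
  \<^prop>\<open>(x, y) \<in> r\<close> means that \<open>x\<close> precedes or equals \<open>y\<close>.\<close>

definition is_least_in :: "'a rel \<Rightarrow> 'a set \<Rightarrow> 'a \<Rightarrow> bool" where
  "is_least_in r X a \<longleftrightarrow> a \<in> X \<and> (\<forall>x\<in>X. (a, x) \<in> r)"

definition is_greatest_in :: "'a rel \<Rightarrow> 'a set \<Rightarrow> 'a \<Rightarrow> bool" where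
  "is_greatest_in r X b \<longleftrightarrow> b \<in> X \<and> (\<forall>x\<in>X. (x, b) \<in> r)"

definition ord_span :: "'a rel \<Rightarrow> 'a set \<Rightarrow> 'a set" where
  "ord_span r X = {v. \<exists>a b. is_least_in r X a \<and> is_greatest_in r X b \<and> (a, v) \<in> r \<and> (v, b) \<in> r}"

definition conflict :: "'a rel \<Rightarrow> 'a set \<Rightarrow> 'a set \<Rightarrow> bool" where
  "conflict r X Y \<longleftrightarrow> ord_span r X \<inter> ord_span r Y \<noteq> {}"

definition interfering_parts ::
    "'a set set \<Rightarrow> 'a rel \<Rightarrow> 'a set set \<Rightarrow> 'a set \<Rightarrow> 'a set set" where
  "interfering_parts E r P X = {Y \<in> P - {X}. conflict r Y (\<Union>(red_closed_nbhd E P X))}"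

definition part_stretch :: "'a set set \<Rightarrow> 'a rel \<Rightarrow> 'a set set \<Rightarrow> 'a set \<Rightarrow> nat" where
  "part_stretch E r P X = card (interfering_parts E r P X)"

definition stretch :: "'a set set \<Rightarrow> 'a rel \<Rightarrow> 'a set set \<Rightarrow> nat" where
  "stretch E r P = (SUP X\<in>P. part_stretch E r P X)"

text \<open>On natural numbers \<^term>\<open>Inf\<close> of a nonempty set is its minimum.  Both index sets below
  are nonempty for finite \<open>V\<close> with at least one vertex: see \<open>partition_seq_exists\<close> below for
  the first.\<close>

definition stw_ord :: "'a set \<Rightarrow> 'a set set \<Rightarrow> 'a rel \<Rightarrow> nat" where
  "stw_ord V E r = (INF P\<in>{P. partition_seq V P}. SUP i\<in>{1..card V}. stretch E r (P i))"

definition stw :: "'a set \<Rightarrow> 'a set set \<Rightarrow> nat" where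
  "stw V E = (INF r\<in>{r. linear_order_on V r}. stw_ord V E r)"

lemma merging_exists:
  assumes "finite V" "partition_on V Q" "card Q = k" "k \<ge> 1"
  shows "\<exists>P. (\<forall>i\<in>{1..k}. partition_on V (P i)) \<and> P k = Q \<and> P 1 = {V} \<and>
     (\<forall>i\<in>{1..<k}. \<exists>X\<in>P (Suc i). \<exists>Y\<in>P (Suc i).
        X \<noteq> Y \<and> P i = insert (X \<union> Y) (P (Suc i) - {X, Y}))"
  using assms(4,2,3)
proof (induction k arbitrary: Q rule: dec_induct)
  case base
  then obtain X where "Q = {X}" by (auto simp: card_1_singleton_iff)
  with base have "Q = {V}" by (auto simp: partition_on_def)
  with base show ?case by (intro exI[of _ "\<lambda>_. Q"]) auto
next
  case (step k)
  have fin: "finite Q" using step.prems step.hyps card.infinite by fastforce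
  obtain X Y where XY: "X \<in> Q" "Y \<in> Q" "X \<noteq> Y"
    using step.prems step.hyps card_le_Suc0_iff_eq[OF fin] by fastforce
  let ?Q = "insert (X \<union> Y) (Q - {X, Y})"
  have Q: "\<Union>Q = V" "disjoint Q" "{} \<notin> Q"
    using step.prems by (auto simp: partition_on_def)
  have dj: "A \<inter> B = {}" if "A \<in> Q" "B \<in> Q" "A \<noteq> B" for A B
    using Q(2) that by (auto simp: pairwise_def disjnt_def)
  have part: "partition_on V ?Q"
  proof (rule partition_onI)
    show "\<Union>?Q = V" using Q(1) XY by auto
    show "{} \<notin> ?Q" using Q(3) XY by auto
    fix A B assume "A \<in> ?Q" "B \<in> ?Q" "A \<noteq> B"
    then show "disjnt A B" using dj XY unfolding disjnt_def by auto
  qed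
  have "X \<union> Y \<notin> Q"
  proof
    assume "X \<union> Y \<in> Q"
    then have "X \<union> Y = X" "X \<union> Y = Y"
      using dj[of "X \<union> Y" X] dj[of "X \<union> Y" Y] XY Q(3) by auto
    then show False using XY by simp
  qed
  then have "card ?Q = Suc (card (Q - {X, Y}))" using fin by simp
  also have "\<dots> = k" using fin XY step.prems step.hyps by (simp add: card_Diff_subset)
  finally have card: "card ?Q = k" .
  obtain P where P: "\<forall>i\<in>{1..k}. partition_on V (P i)" "P k = ?Q" "P 1 = {V}"
    "\<forall>i\<in>{1..<k}. \<exists>X\<in>P (Suc i). \<exists>Y\<in>P (Suc i).
        X \<noteq> Y \<and> P i = insert (X \<union> Y) (P (Suc i) - {X, Y})"
    using step.IH[OF part card] by (elim exE conjE) (rule that)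
  have "\<exists>X\<in>(P(Suc k := Q)) (Suc i). \<exists>Y\<in>(P(Suc k := Q)) (Suc i).
        X \<noteq> Y \<and> (P(Suc k := Q)) i = insert (X \<union> Y) ((P(Suc k := Q)) (Suc i) - {X, Y})"
    if "i \<in> {1..<Suc k}" for i
  proof (cases "i = k")
    case True
    then show ?thesis using XY P(2)
      by (intro bexI[of _ X] bexI[of _ Y]) simp_all
  next
    case False
    then have "i \<in> {1..<k}" using that by simp
    from bspec[OF P(4) this] False that show ?thesis by simp
  qed
  moreover have "partition_on V ((P(Suc k := Q)) i)" if "i \<in> {1..Suc k}" for i
    using P(1) step.prems that by (cases "i = Suc k") simp_all
  moreover have "(P(Suc k := Q)) (Suc k) = Q" "(P(Suc k := Q)) 1 = {V}"
    using P(3) step.hyps by simp_all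
  ultimately show ?case by (intro exI[of _ "P(Suc k := Q)"] conjI ballI)
qed

lemma partition_seq_exists:
  assumes "finite V" "V \<noteq> {}"
  shows "\<exists>P. partition_seq V P"
proof -
  have "{{v} | v. v \<in> V} = (\<lambda>v. {v}) ` V" by auto
  then have "card {{v} | v. v \<in> V} = card V" by (simp add: card_image)
  moreover have "partition_on V {{v} | v. v \<in> V}"
    by (auto simp: partition_on_def pairwise_def)
  moreover have "card V \<ge> 1" using assms by (simp add: Suc_le_eq card_gt_0_iff)
  ultimately show ?thesis
    using merging_exists[OF assms(1)] unfolding partition_seq_def by blast
qed

end

(* The line consists of n blocks of length 2^m, one starting at each vertex of G, and the path of the
   j-th edge (j = 0, ..., m-1) is laid out on the odd multiples of 2^j between its two ends.  Then
   all parts ever used are intervals of the line: at stage j, merge along the intervals between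
   consecutive multiples of 2^(j+1), so that each merged part has red edges only to parts a bounded
   number of intervals away, while the paths not merged yet pass through the window in boundedly
   many single vertices.

   In general, give each vertex a height and remove the cuts between consecutive vertices by
   increasing height.  It suffices that, for each edge uv, boundedly many vertices between u and v
   have height at least min (h u) (h v). *)

theory Submission
  imports Defs "HOL-Library.Product_Lexorder" "HOL-Library.Infinite_Set"
begin

section \<open>Bounding stretch-width by one order and one partition sequence\<close>

lemma Sup_image_nat_le:
  fixes f :: "'c \<Rightarrow> nat"
  assumes "\<And>x. x \<in> A \<Longrightarrow> f x \<le> K"
  shows "(SUP x\<in>A. f x) \<le> K"
  using assms by (cases "A = {}") (auto intro: cSUP_least)

lemma stw_le:
  assumes "linear_order_on V r" and "partition_seq V P"
    and "\<And>i X. \<lbrakk>1 \<le> i; i \<le> card V; X \<in> P i\<rbrakk> \<Longrightarrow> part_stretch E r (P i) X \<le> K"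
  shows "stw V E \<le> K"
proof -
  have "stw V E \<le> stw_ord V E r"
    unfolding stw_def using assms(1) by (intro cINF_lower) auto
  also have "\<dots> \<le> (SUP i\<in>{1..card V}. stretch E r (P i))"
    unfolding stw_ord_def using assms(2) by (intro cINF_lower) auto
  also have "\<dots> \<le> K"
    unfolding stretch_def by (intro Sup_image_nat_le) (simp add: assms(3))
  finally show ?thesis .
qed

text \<open>Two singletons are never inhomogeneous, so a red edge carries an edge of the graph with
  at least one endpoint in a larger part. Later arguments use redness only in this form.\<close>

lemma red_edge_endpoints:
  assumes "{X, Y} \<in> red_edges E P"
  obtains u v where "u \<in> X" "v \<in> Y" "{u, v} \<in> E" "X \<noteq> {u} \<or> Y \<noteq> {v}"
proof -
  obtain X' Y' where XY: "{X, Y} = {X', Y'}" and "inhomogeneous E X' Y'"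
    using assms unfolding red_edges_def by auto
  then obtain u v where uv: "u \<in> X'" "v \<in> Y'" "{u, v} \<in> E" "X' \<noteq> {u} \<or> Y' \<noteq> {v}"
    unfolding inhomogeneous_def by (metis singletonD)
  from XY consider "X' = X" "Y' = Y" | "X' = Y" "Y' = X"
    by (auto simp: doubleton_eq_iff)
  then show thesis
  proof cases
    case 1
    then show thesis using uv that by blast
  next
    case 2
    then show thesis using uv that[of v u] by (simp add: insert_commute) blast
  qed
qed


section \<open>Interval partitions\<close>

text \<open>A partition into intervals is encoded by the set \<open>C\<close> of their left ends,
  which contains 0. The leader is the left end of the interval around \<open>i\<close>.\<close>

definition leader :: "nat set \<Rightarrow> nat \<Rightarrow> nat" where
  "leader C i = Max {c \<in> C. c \<le> i}"

context
  fixes C :: "nat set"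
  assumes fin: "finite C" and zero: "0 \<in> C"
begin

lemma leader_mem: "leader C i \<in> C" and leader_le: "leader C i \<le> i"
proof -
  have "leader C i \<in> {c \<in> C. c \<le> i}"
    unfolding leader_def using fin zero by (intro Max_in) auto
  then show "leader C i \<in> C" "leader C i \<le> i" by auto
qed

lemma leader_ge: "c \<in> C \<Longrightarrow> c \<le> i \<Longrightarrow> c \<le> leader C i"
  unfolding leader_def using fin by (intro Max_ge) auto

lemma leader_self: "c \<in> C \<Longrightarrow> leader C c = c"
  using leader_ge[of c c] leader_le[of c] by auto

lemma leader_mono: "i \<le> j \<Longrightarrow> leader C i \<le> leader C j"
  using leader_ge leader_mem leader_le le_trans by blast

lemma leader_eqI: "\<lbrakk>l \<in> C; l \<le> i; \<And>c. \<lbrakk>c \<in> C; c \<le> i\<rbrakk> \<Longrightarrow> c \<le> l\<rbrakk> \<Longrightarrow> leader C i = l"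
  by (simp add: leader_ge leader_le leader_mem order_antisym)

end

text \<open>Without the left end \<open>c\<close>, its interval is absorbed by the preceding one,
  that of \<open>c - 1\<close>; all others keep their left ends.\<close>

lemma leader_remove:
  assumes "finite C" "0 \<in> C" "c \<in> C" "0 < c"
  shows "leader (C - {c}) i = (if leader C i = c then leader C (c - 1) else leader C i)"
proof (rule leader_eqI)
  note l = leader_mem[OF assms(1,2)] leader_le[OF assms(1,2)] leader_ge[OF assms(1,2)]
  show "(if leader C i = c then leader C (c - 1) else leader C i) \<in> C - {c}"
    using l(1) l(2)[of "c - 1"] assms(4) by auto
  show "(if leader C i = c then leader C (c - 1) else leader C i) \<le> i"
    using l(2)[of i] l(2)[of "c - 1"] by auto
  fix d assume "d \<in> C - {c}" "d \<le> i"
  then show "d \<le> (if leader C i = c then leader C (c - 1) else leader C i)"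
    using l(3)[of d i] l(3)[of d "c - 1"] by auto
qed (use assms in auto)

definition interval_part :: "'b set \<Rightarrow> ('b \<Rightarrow> nat) \<Rightarrow> nat set \<Rightarrow> nat \<Rightarrow> 'b set" where
  "interval_part V idx C c = {v \<in> V. leader C (idx v) = c}"

locale enumerated_vertices =
  fixes V :: "'b set" and idx :: "'b \<Rightarrow> nat" and N :: nat
  assumes bij: "bij_betw idx V {..<N}"
begin

abbreviation "part \<equiv> interval_part V idx"

definition ord :: "'b rel" where
  "ord = {(u, v). u \<in> V \<and> v \<in> V \<and> idx u \<le> idx v}"

lemma idx_less: "v \<in> V \<Longrightarrow> idx v < N"
  using bij by (auto simp: bij_betw_def)

lemma idx_eq_iff: "u \<in> V \<Longrightarrow> v \<in> V \<Longrightarrow> idx u = idx v \<longleftrightarrow> u = v"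
  using bij by (auto simp: bij_betw_def inj_on_def)

lemma ex_idx: "i < N \<Longrightarrow> \<exists>v\<in>V. idx v = i"
  using bij_betw_imp_surj_on[OF bij] by (metis imageE lessThan_iff)

lemma card_V: "card V = N"
  using bij_betw_same_card[OF bij] by simp

lemma linear_order_ord: "linear_order_on V ord"
  unfolding order_on_defs refl_on_def trans_def antisym_def total_on_def ord_def
  using idx_eq_iff by auto

context
  fixes C :: "nat set"
  assumes C: "C \<subseteq> {..<N}" "0 \<in> C"
begin

lemma finite_C: "finite C"
  using C(1) finite_subset by blast

lemmas lead = leader_mem[OF finite_C C(2)] leader_le[OF finite_C C(2)]
  leader_self[OF finite_C C(2)] leader_mono[OF finite_C C(2)]
  leader_ge[OF finite_C C(2)]

lemma part_nonempty: "c \<in> C \<Longrightarrow> part C c \<noteq> {}"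
  using ex_idx[of c] C(1) lead(3)[of c] by (auto simp: interval_part_def)

lemma part_inj: "inj_on (part C) C"
proof (rule inj_onI)
  fix c d assume "c \<in> C" "d \<in> C" "part C c = part C d"
  moreover obtain v where "v \<in> part C c" using part_nonempty[OF \<open>c \<in> C\<close>] by auto
  ultimately show "c = d" by (auto simp: interval_part_def)
qed

lemma partition_on_parts: "partition_on V (part C ` C)"
proof (rule partition_onI)
  show "\<Union>(part C ` C) = V" using lead(1) by (auto simp: interval_part_def)
  show "{} \<notin> part C ` C" using part_nonempty by auto
qed (auto simp: interval_part_def disjnt_def)

lemma remove_leader:
  assumes "c \<in> C" "0 < c"
  shows "\<exists>X\<in>part C ` C. \<exists>Y\<in>part C ` C. X \<noteq> Y \<and>
    part (C - {c}) ` (C - {c}) = insert (X \<union> Y) (part C ` C - {X, Y})"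
proof -
  \<comment> \<open>The interval just before \<open>c\<close> starts at \<open>b\<close>; its part
    absorbs the part of \<open>c\<close>.\<close>
  define b where "b = leader C (c - 1)"
  have b: "b \<in> C" "b \<noteq> c" unfolding b_def using lead(1,2)[of "c - 1"] assms by auto
  have p: "part (C - {c}) x = (if x = b then part C c \<union> part C b else part C x)"
    if "x \<in> C - {c}" for x
    using that b leader_remove[OF finite_C C(2) assms] by (auto simp: interval_part_def b_def)
  have "part (C - {c}) ` (C - {c}) = insert (part C c \<union> part C b) (part C ` (C - {c, b}))"
    using b p by (auto simp: image_iff)
  also have "part C ` (C - {c, b}) = part C ` C - {part C c, part C b}"
    using part_inj b assms(1) by (subst inj_on_image_set_diff[of _ C]) auto
  finally show ?thesis
    using b assms(1) part_inj by (intro bexI[of _ "part C c"] bexI[of _ "part C b"])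
      (auto dest: inj_onD)
qed

lemma ord_span_part: "ord_span ord (part C c) \<subseteq> part C c"
proof
  fix v assume "v \<in> ord_span ord (part C c)"
  then obtain a b where "a \<in> part C c" "b \<in> part C c" "(a, v) \<in> ord" "(v, b) \<in> ord"
    by (auto simp: ord_span_def is_least_in_def is_greatest_in_def)
  then show "v \<in> part C c"
    using lead(4)[of "idx a" "idx v"] lead(4)[of "idx v" "idx b"]
    by (auto simp: ord_def interval_part_def)
qed

text \<open>Since all parts are intervals, the parts interfering with \<open>X\<close> lie between \<open>X\<close> and one of
  its red neighbours.\<close>

lemma part_stretch_le:
  assumes "c \<in> C"
    and red: "\<And>d. \<lbrakk>d \<in> C; {part C c, part C d} \<in> red_edges E (part C ` C)\<rbrakk>
      \<Longrightarrow> card (C \<inter> {min c d..max c d}) \<le> K"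
    and "1 \<le> K"
  shows "part_stretch E ord (part C ` C) (part C c) \<le> 2 * K"
proof -
  define R where "R = insert c {d \<in> C. {part C c, part C d} \<in> red_edges E (part C ` C)}"
  have nb: "red_closed_nbhd E (part C ` C) (part C c) = part C ` R"
    unfolding red_closed_nbhd_def R_def by auto
  have "finite R" "R \<noteq> {}" "c \<in> R" "R \<subseteq> C" unfolding R_def using finite_C assms(1) by auto
  define a b where "a = Min R" and "b = Max R"
  have ab: "a \<in> R" "b \<in> R" "a \<le> c" "c \<le> b" "\<And>d. d \<in> R \<Longrightarrow> a \<le> d" "\<And>d. d \<in> R \<Longrightarrow> d \<le> b"
    unfolding a_def b_def using \<open>finite R\<close> \<open>R \<noteq> {}\<close> \<open>c \<in> R\<close> by auto
  \<comment> \<open>For \<open>d = c\<close> the window contains \<open>c\<close> alone, which is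
    where \<open>1 \<le> K\<close> enters.\<close>
  have near: "card (C \<inter> {min c d..max c d}) \<le> K" if "d \<in> R" for d
  proof (cases "d = c")
    case True
    then show ?thesis using assms(1,3) by simp
  next
    case False
    then show ?thesis using that red unfolding R_def by auto
  qed
  \<comment> \<open>The span of \<open>Y\<close> stays inside \<open>Y\<close>, so a conflict puts a
    vertex of \<open>Y\<close> between vertices of two parts in the closed red neighbourhood.
    Monotonicity of leaders then places the left end of \<open>Y\<close> between \<open>a\<close>
    and \<open>b\<close>.\<close>
  have "interfering_parts E ord (part C ` C) (part C c) \<subseteq> part C ` (C \<inter> {a..b})"
  proof
    fix Y assume "Y \<in> interfering_parts E ord (part C ` C) (part C c)"
    then obtain y where y: "y \<in> C" "Y = part C y"
      and "conflict ord Y (\<Union>(part C ` R))"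
      by (auto simp: interfering_parts_def nb)
    then obtain v where v: "v \<in> part C y" "v \<in> ord_span ord (\<Union>(part C ` R))"
      using ord_span_part by (auto simp: conflict_def)
    then obtain p q s t where "p \<in> R" "q \<in> R" "s \<in> part C p" "t \<in> part C q"
      "(s, v) \<in> ord" "(v, t) \<in> ord"
      by (auto simp: ord_span_def is_least_in_def is_greatest_in_def)
    then have "p \<le> y" "y \<le> q"
      using v(1) lead(4)[of "idx s" "idx v"] lead(4)[of "idx v" "idx t"]
      by (auto simp: ord_def interval_part_def)
    then have "a \<le> y" "y \<le> b" using ab(5)[OF \<open>p \<in> R\<close>] ab(6)[OF \<open>q \<in> R\<close>] by auto
    then show "Y \<in> part C ` (C \<inter> {a..b})" using y by auto
  qed
  then have "part_stretch E ord (part C ` C) (part C c) \<le> card (part C ` (C \<inter> {a..b}))"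
    unfolding part_stretch_def using finite_C by (intro card_mono) auto
  also have "\<dots> \<le> card (C \<inter> {a..b})"
    using finite_C by (intro card_image_le) auto
  \<comment> \<open>Splitting at \<open>c\<close> gives two windows with at most \<open>K\<close>
    left ends each.\<close>
  also have "\<dots> \<le> card ((C \<inter> {min c a..max c a}) \<union> (C \<inter> {min c b..max c b}))"
    using finite_C ab(3,4) by (intro card_mono) auto
  also have "\<dots> \<le> K + K"
    using near[OF ab(1)] near[OF ab(2)] card_Un_le by (meson add_mono le_trans)
  finally show ?thesis by simp
qed

end

end


section \<open>Removing cuts by increasing height\<close>

locale local_edges = enumerated_vertices V idx N
  for V :: "'b set" and idx :: "'b \<Rightarrow> nat" and N :: nat +
  fixes E :: "'b set set" and ht :: "nat \<Rightarrow> nat" and D :: nat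
  assumes edge: "e \<in> E \<Longrightarrow> \<exists>u\<in>V. \<exists>v\<in>V. e = {u, v} \<and> idx u \<le> idx v \<and>
    card {k \<in> {idx u..idx v}. min (ht (idx u)) (ht (idx v)) \<le> ht k} \<le> D"
begin

text \<open>The cut \<open>c\<close> separates indices \<open>c - 1\<close> and \<open>c\<close>.
  With the maximum, the cuts next to a vertex outlast every cut whose two sides are both lower than
  it.\<close>

definition cut_level :: "nat \<Rightarrow> nat" where
  "cut_level c = max (ht (c - 1)) (ht c)"

definition cuts :: "nat list" where
  "cuts = sort_key cut_level [1..<N]"

text \<open>There are \<open>N - 1\<close> cuts, so dropping \<open>N - i\<close> of them leaves
  \<open>i - 1\<close>; together with 0 this gives \<open>i\<close> parts for
  \<open>1 \<le> i \<le> N\<close>.\<close>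

definition leaders :: "nat \<Rightarrow> nat set" where
  "leaders i = insert 0 (set (drop (N - i) cuts))"

lemma cuts: "set cuts = {1..<N}" "distinct cuts" "length cuts = N - 1"
  "sorted (map cut_level cuts)"
  by (auto simp: cuts_def)

lemma leaders_subset: "0 < N \<Longrightarrow> leaders i \<subseteq> {..<N}"
  using cuts(1) set_drop_subset[of "N - i" cuts] by (auto simp: leaders_def)

text \<open>A missing cut lies in the dropped prefix of a list sorted by level.\<close>

lemma leaders_upward:
  assumes "c \<in> leaders i" "0 < c" "0 < g" "g < N" "g \<notin> leaders i"
  shows "cut_level g \<le> cut_level c"
proof -
  let ?k = "N - i"
  have g: "g \<in> set (take ?k cuts)" and c: "c \<in> set (drop ?k cuts)"
    using assms cuts(1) append_take_drop_id[of ?k cuts] set_append[of "take ?k cuts" "drop ?k cuts"]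
    by (auto simp: leaders_def)
  have "sorted (map cut_level (take ?k cuts @ drop ?k cuts))" using cuts(4) by simp
  then show ?thesis unfolding map_append sorted_append using g c by auto
qed

lemma leaders_step:
  assumes "1 \<le> i" "i < N"
  obtains c where "c \<in> leaders (Suc i)" "0 < c" "leaders i = leaders (Suc i) - {c}"
proof
  let ?k = "N - Suc i"
  have len: "?k < length cuts" and k: "N - i = Suc ?k" using assms cuts(3) by auto
  have d: "drop ?k cuts = cuts ! ?k # drop (N - i) cuts"
    using Cons_nth_drop_Suc[OF len] k by simp
  have pos: "0 < cuts ! ?k" using nth_mem[OF len] cuts(1) by auto
  show "cuts ! ?k \<in> leaders (Suc i)" by (simp add: leaders_def d)
  show "0 < cuts ! ?k" by (rule pos)
  have "distinct (drop ?k cuts)" using cuts(2) by simp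
  then have "cuts ! ?k \<notin> set (drop (N - i) cuts)" unfolding d by simp
  then show "leaders i = leaders (Suc i) - {cuts ! ?k}"
    using pos unfolding leaders_def d by auto
qed

text \<open>A cut next to \<open>u\<close> has already been removed, so every remaining cut is adjacent to a vertex at
  least as high as \<open>u\<close>.\<close>

lemma high_near_cut:
  assumes u: "u \<in> V" "part (leaders i) (leader (leaders i) (idx u)) \<noteq> {u}"
    and c: "c \<in> leaders i" "0 < c"
  shows "ht (idx u) \<le> ht c \<or> ht (idx u) \<le> ht (c - 1)"
proof -
  let ?L = "leaders i"
  have "0 < N" using idx_less[OF u(1)] by simp
  then have C: "?L \<subseteq> {..<N}" "0 \<in> ?L" using leaders_subset by (auto simp: leaders_def)
  note l = lead[OF C]
  have "u \<in> part ?L (leader ?L (idx u))" using u(1) by (simp add: interval_part_def)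
  then obtain w where w: "w \<in> V" "leader ?L (idx w) = leader ?L (idx u)" "w \<noteq> u"
    using u(2) by (auto simp: interval_part_def)
  \<comment> \<open>The cut next to \<open>u\<close> on the side of \<open>w\<close>. It is gone
    because \<open>u\<close> and \<open>w\<close> share a part.\<close>
  define g where "g = (if idx w < idx u then idx u else Suc (idx u))"
  have "idx w \<noteq> idx u" using w u(1) idx_eq_iff by auto
  have "g \<notin> ?L"
  proof
    assume g: "g \<in> ?L"
    show False
    proof (cases "idx w < idx u")
      case True
      then have "idx u \<le> leader ?L (idx u)" using g l(3)[of "idx u"] by (simp add: g_def)
      then show False using w(2) True l(2)[of "idx w"] by simp
    next
      case False
      then have "Suc (idx u) \<le> idx w" using \<open>idx w \<noteq> idx u\<close> by simp
      then have "Suc (idx u) \<le> leader ?L (idx w)" using g False l(5) by (simp add: g_def)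
      then show False using w(2) l(2)[of "idx u"] by simp
    qed
  qed
  moreover have "0 < g" "g < N"
    using \<open>idx w \<noteq> idx u\<close> idx_less[OF u(1)] idx_less[OF w(1)] by (auto simp: g_def)
  ultimately have "cut_level g \<le> cut_level c" using leaders_upward[OF c] by simp
  moreover have "ht (idx u) \<le> cut_level g" by (auto simp: g_def cut_level_def)
  ultimately show ?thesis by (auto simp: cut_level_def)
qed

lemma red_edge_few_leaders:
  assumes cd: "c \<in> leaders i" "d \<in> leaders i"
    and "{part (leaders i) c, part (leaders i) d} \<in> red_edges E (part (leaders i) ` leaders i)"
  shows "card (leaders i \<inter> {min c d..max c d}) \<le> 1 + 2 * D"
proof -
  let ?L = "leaders i"
  obtain x y where xy: "x \<in> part ?L c" "y \<in> part ?L d" "{x, y} \<in> E"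
      "part ?L c \<noteq> {x} \<or> part ?L d \<noteq> {y}"
    using red_edge_endpoints[OF assms(3)] .
  obtain u v where uv: "u \<in> V" "v \<in> V" "{x, y} = {u, v}" "idx u \<le> idx v"
    and D: "card {k \<in> {idx u..idx v}. min (ht (idx u)) (ht (idx v)) \<le> ht k} \<le> D"
    using edge[OF xy(3)] by auto
  define H where "H = {k \<in> {idx u..idx v}. min (ht (idx u)) (ht (idx v)) \<le> ht k}"
  have "0 < N" using idx_less[OF uv(1)] by simp
  then have C: "?L \<subseteq> {..<N}" "0 \<in> ?L" using leaders_subset by (auto simp: leaders_def)
  note l = lead[OF C]
  \<comment> \<open>The endpoints come sorted by index, so \<open>u\<close> may be \<open>x\<close>
    or \<open>y\<close>; \<open>min\<close> and \<open>max\<close> absorb the swap.\<close>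
  have ends: "min c d = leader ?L (idx u)" "max c d = leader ?L (idx v)"
    and ns: "part ?L (leader ?L (idx u)) \<noteq> {u} \<or> part ?L (leader ?L (idx v)) \<noteq> {v}"
    using xy uv(3) l(4)[OF uv(4)] by (auto simp: interval_part_def doubleton_eq_iff)
  have "?L \<inter> {min c d..max c d} \<subseteq> insert (min c d) (H \<union> Suc ` H)"
  proof
    fix k assume k: "k \<in> ?L \<inter> {min c d..max c d}"
    show "k \<in> insert (min c d) (H \<union> Suc ` H)"
    proof (cases "k \<le> idx u")
      case True
      then show ?thesis using k l(5)[of k "idx u"] ends by auto
    next
      case False
      have kv: "k \<le> idx v" using k ends(2) l(2)[of "idx v"] by auto
      \<comment> \<open>The endpoint whose part is larger than a singleton supplies the bound; its
        height is at least the minimum.\<close>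
      have "min (ht (idx u)) (ht (idx v)) \<le> ht k \<or> min (ht (idx u)) (ht (idx v)) \<le> ht (k - 1)"
        using ns high_near_cut[OF uv(1), of i k] high_near_cut[OF uv(2), of i k] k False
        unfolding min_le_iff_disj by (metis IntD1 neq0_conv zero_le)
      then have "k \<in> H \<or> k - 1 \<in> H" using False kv unfolding H_def by auto
      moreover have "k = Suc (k - 1)" using False by simp
      ultimately show ?thesis by blast
    qed
  qed
  moreover have "finite H" by (simp add: H_def)
  ultimately have "card (?L \<inter> {min c d..max c d}) \<le> card (insert (min c d) (H \<union> Suc ` H))"
    by (intro card_mono) auto
  also have "\<dots> \<le> Suc (card (H \<union> Suc ` H))"
    by (rule card_insert_le_m1) auto
  also have "\<dots> \<le> Suc (card H + card H)"
    using card_Un_le[of H "Suc ` H"] card_image_le[OF \<open>finite H\<close>, of Suc] by simp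
  finally show ?thesis using D by (simp add: H_def)
qed

text \<open>The constant is \<open>2 * K\<close> with \<open>K = 1 + 2 * D\<close>, the bound on
  left ends per red edge.\<close>

lemma stw_bound: "stw V E \<le> 4 * D + 2"
proof (cases "N = 0")
  case True
  then have "V = {}" using bij by (auto simp: bij_betw_def)
  \<comment> \<open>Without vertices, \<open>P 0\<close> must be the empty family and
    \<open>P 1\<close> must be \<open>{V} = {{}}\<close>.\<close>
  then have "partition_seq V (\<lambda>i. if i = 0 then {} else {{}})"
    by (auto simp: partition_seq_def)
  with linear_order_ord show ?thesis
    using \<open>V = {}\<close> by (intro stw_le) auto
next
  case False
  then have C: "leaders i \<subseteq> {..<N}" "0 \<in> leaders i" for i
    using leaders_subset by (auto simp: leaders_def)
  define P where "P i = part (leaders i) ` leaders i" for i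
  have N: "leaders N = {..<N}" using False cuts(1) by (auto simp: leaders_def)
  have 1: "leaders 1 = {0}" using cuts(3) by (simp add: leaders_def)
  have sing: "part {..<N} i = {v \<in> V. idx v = i}" for i
    using lead(3)[of "{..<N}"] False idx_less by (auto simp: interval_part_def)
  have "P N = {{v} | v. v \<in> V}"
  proof -
    have "{w \<in> V. idx w = idx v} = {v}" if "v \<in> V" for v
      using that idx_eq_iff by auto
    then have "P N = (\<lambda>v. {v}) ` V"
      unfolding P_def N bij_betw_imp_surj_on[OF bij, symmetric] image_image
      by (intro image_cong) (auto simp: sing bij_betw_imp_surj_on[OF bij])
    then show ?thesis by auto
  qed
  moreover have "P 1 = {V}"
    using lead(1)[of "{0}"] False unfolding P_def 1 by (auto simp: interval_part_def)
  moreover have "\<exists>X\<in>P (Suc i). \<exists>Y\<in>P (Suc i). X \<noteq> Y \<and> P i = insert (X \<union> Y) (P (Suc i) - {X, Y})"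
    if i: "i \<in> {1..<N}" for i
  proof -
    obtain c where "c \<in> leaders (Suc i)" "0 < c" "leaders i = leaders (Suc i) - {c}"
      using i leaders_step[of i] by auto
    then show ?thesis using remove_leader[OF C, of c "Suc i"] by (simp add: P_def)
  qed
  ultimately have seq: "partition_seq V P"
    unfolding partition_seq_def card_V using partition_on_parts[OF C] by (auto simp: P_def)
  show ?thesis
  proof (rule stw_le[OF linear_order_ord seq])
    fix i X assume "X \<in> P i"
    then obtain c where c: "c \<in> leaders i" "X = part (leaders i) c" by (auto simp: P_def)
    have "part_stretch E ord (P i) X \<le> 2 * (1 + 2 * D)"
      unfolding P_def c(2) using c(1) red_edge_few_leaders[OF c(1)]
      by (intro part_stretch_le[OF C]) auto
    then show "part_stretch E ord (P i) X \<le> 4 * D + 2" by simp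
  qed
qed

end

text \<open>Only the order of the keys matters, so they are replaced by their ranks
  \<open>0, ..., N - 1\<close>.\<close>

lemma stw_le_of_local_edges:
  fixes key :: "'b \<Rightarrow> 'k::wellorder" and h :: "'b \<Rightarrow> nat"
  assumes "finite V" and inj: "inj_on key V"
    and edge: "\<And>e. e \<in> E \<Longrightarrow> \<exists>u\<in>V. \<exists>v\<in>V. e = {u, v} \<and> key u \<le> key v \<and>
      card {w \<in> V. key u \<le> key w \<and> key w \<le> key v \<and> min (h u) (h v) \<le> h w} \<le> D"
  shows "stw V E \<le> 4 * D + 2"
proof -
  define N where "N = card (key ` V)"
  obtain g where g: "bij_betw g {..<N} (key ` V)" "strict_mono_on {..<N} g"
    using ex_bij_betw_strict_mono_card[of "key ` V"] assms(1) unfolding N_def by auto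
  define idx where "idx = inv_into {..<N} g \<circ> key"
  have bij: "bij_betw idx V {..<N}"
    unfolding idx_def using inj bij_betw_inv_into[OF g(1)]
    by (intro bij_betw_trans[of key V "key ` V"]) (auto simp: bij_betw_def)
  have gi: "g (idx v) = key v" "idx v < N" if "v \<in> V" for v
    using that g(1) bij by (auto simp: idx_def bij_betw_inv_into_right bij_betw_def)
  have le: "idx u \<le> idx v \<longleftrightarrow> key u \<le> key v" if "u \<in> V" "v \<in> V" for u v
    using that gi strict_mono_on_less_eq[OF g(2), of "idx u" "idx v"] by auto
  define ht where "ht k = h (inv_into V idx k)" for k
  have ht: "ht (idx v) = h v" if "v \<in> V" for v
    using that bij by (simp add: ht_def bij_betw_inv_into_left)
  interpret local_edges V idx N E ht D
  proof
    fix e assume "e \<in> E"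
    then obtain u v where uv: "u \<in> V" "v \<in> V" "e = {u, v}" "key u \<le> key v"
      and D: "card {w \<in> V. key u \<le> key w \<and> key w \<le> key v \<and> min (h u) (h v) \<le> h w} \<le> D"
      using edge by blast
    let ?A = "{w \<in> V. key u \<le> key w \<and> key w \<le> key v \<and> min (h u) (h v) \<le> h w}"
    \<comment> \<open>Since \<open>idx\<close> preserves the order of keys, each high index in the
      window comes from a high vertex in the key window.\<close>
    have "{k \<in> {idx u..idx v}. min (ht (idx u)) (ht (idx v)) \<le> ht k} \<subseteq> idx ` ?A"
    proof
      fix k assume k: "k \<in> {k \<in> {idx u..idx v}. min (ht (idx u)) (ht (idx v)) \<le> ht k}"
      then have "k < N" using gi(2)[OF uv(2)] by auto
      then obtain w where "w \<in> V" "k = idx w" using bij by (auto simp: bij_betw_def image_iff set_eq_iff)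
      then show "k \<in> idx ` ?A" using k uv le ht by auto
    qed
    then have "card {k \<in> {idx u..idx v}. min (ht (idx u)) (ht (idx v)) \<le> ht k} \<le> card ?A"
      using assms(1) by (intro surj_card_le) auto
    with uv D le show "\<exists>u\<in>V. \<exists>v\<in>V. e = {u, v} \<and> idx u \<le> idx v \<and>
        card {k \<in> {idx u..idx v}. min (ht (idx u)) (ht (idx v)) \<le> ht k} \<le> D"
      by (intro bexI[of _ u] bexI[of _ v]) auto
  qed (rule bij)
  show ?thesis by (rule stw_bound)
qed


section \<open>Layout of a subdivision\<close>

lemma path_interior_conv_nth:
  "path_interior xs = (\<lambda>i. xs ! Suc i) ` {..<length xs - 2}"
proof -
  have "butlast (tl xs) ! i = xs ! Suc i" if "i < length xs - 2" for i
    using that by (simp add: nth_butlast nth_tl)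
  moreover have "length (butlast (tl xs)) = length xs - 2" by simp
  ultimately show ?thesis
    unfolding path_interior_def by (force simp: set_conv_nth)
qed

text \<open>A subdivision may list a path in either direction; invariance under reversal allows each
  to be oriented by the numbering of its ends.\<close>

lemma path_interior_rev: "path_interior (rev xs) = path_interior xs"
proof -
  have "butlast (tl (rev xs)) = rev (butlast (tl xs))"
    by (metis butlast_rev butlast_tl rev_rev_ident)
  then show ?thesis by (simp add: path_interior_def)
qed

lemma path_edges_rev: "path_edges (rev xs) = path_edges xs"
proof -
  have sub: "path_edges (rev ys) \<subseteq> path_edges ys" for ys :: "'b list"
  proof
    fix s assume "s \<in> path_edges (rev ys)"
    then obtain i where i: "Suc i < length ys" "s = {rev ys ! i, rev ys ! Suc i}"
      by (auto simp: path_edges_def)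
    define k where "k = length ys - Suc (Suc i)"
    have "Suc k < length ys" "rev ys ! i = ys ! Suc k" "rev ys ! Suc i = ys ! k"
      using i(1) by (auto simp: k_def rev_nth Suc_diff_Suc)
    then show "s \<in> path_edges ys" using i(2) by (auto simp: path_edges_def)
  qed
  show ?thesis using sub[of xs] sub[of "rev xs"] by auto
qed

text \<open>Unequal exponents would, after cancellation, equate an odd and an even number. Hence
  edges of different levels never share a position.\<close>

lemma pow2_odd_unique:
  fixes x y :: nat
  assumes "2 ^ a * (2 * x + 1) = 2 ^ b * (2 * y + 1)"
  shows "a = b \<and> x = y"
proof -
  have le: "b \<le> a" if eq: "2 ^ a * (2 * x + 1) = 2 ^ b * (2 * y + 1)" for a b x y :: nat
  proof (rule ccontr)
    assume "\<not> b \<le> a"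
    then obtain c where "b = a + Suc c" using less_imp_Suc_add by (metis add_Suc_right not_le)
    with eq have "2 ^ a * (2 * x + 1) = 2 ^ a * (2 ^ Suc c * (2 * y + 1))"
      by (simp only: power_add mult.assoc)
    then have "2 * x + 1 = 2 ^ Suc c * (2 * y + 1)" unfolding mult_cancel_left by simp
    then have "even (2 * x + 1)" by simp
    then show False by simp
  qed
  from le[OF assms] le[OF assms[symmetric]] have "a = b" by simp
  with assms show ?thesis by simp
qed

locale oriented_subdivision =
  fixes V :: "'a set" and E :: "'a set set" and n m :: nat
    and num :: "'a \<Rightarrow> nat" and lev :: "'a set \<Rightarrow> nat"
    and f :: "'a \<Rightarrow> 'b" and q :: "'a set \<Rightarrow> 'b list" and src tgt :: "'a set \<Rightarrow> 'a"
  assumes fin: "finite V" "finite E"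
    and num: "inj_on num V" "\<And>v. v \<in> V \<Longrightarrow> num v < n"
    and lev: "inj_on lev E" "\<And>e. e \<in> E \<Longrightarrow> lev e < m"
    and f: "inj_on f V"
    and q: "\<And>e. e \<in> E \<Longrightarrow> n * 2 ^ m + 2 \<le> length (q e)" "\<And>e. e \<in> E \<Longrightarrow> distinct (q e)"
    and ends: "\<And>e. e \<in> E \<Longrightarrow> src e \<in> V" "\<And>e. e \<in> E \<Longrightarrow> tgt e \<in> V"
      "\<And>e. e \<in> E \<Longrightarrow> num (src e) < num (tgt e)"
      "\<And>e. e \<in> E \<Longrightarrow> hd (q e) = f (src e)" "\<And>e. e \<in> E \<Longrightarrow> last (q e) = f (tgt e)"
    and interior: "\<And>e. e \<in> E \<Longrightarrow> path_interior (q e) \<inter> f ` V = {}"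
      "\<And>e e'. \<lbrakk>e \<in> E; e' \<in> E; e \<noteq> e'\<rbrakk> \<Longrightarrow> path_interior (q e) \<inter> path_interior (q e') = {}"
begin

text \<open>The vertices of \<open>G\<close> sit at multiples of \<open>2 ^ m\<close>.  The path of an edge \<open>e\<close> of level \<open>j\<close>
  visits the odd multiples of \<open>2 ^ j\<close> between its ends in increasing order; the \<open>slack e\<close>
  surplus inner vertices are piled up at the first of these positions (hence the truncated
  subtraction in \<open>pos\<close>), where all but the first and the last of the pile get height 0.\<close>

definition len :: "'a set \<Rightarrow> nat" where
  "len e = length (q e) - 2"

text \<open>The number of odd multiples of \<open>2 ^ lev e\<close> between the ends: one in each
  stretch of length \<open>2 ^ Suc (lev e)\<close>.\<close>

definition steps :: "'a set \<Rightarrow> nat" where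
  "steps e = (num (tgt e) - num (src e)) * 2 ^ (m - Suc (lev e))"

definition slack :: "'a set \<Rightarrow> nat" where
  "slack e = len e - steps e"

text \<open>Names for the vertices of the subdivision: \<open>Inr (e, i)\<close> is inner vertex
  \<open>i\<close> of the path of \<open>e\<close>, counted from 0 and thus entry
  \<open>Suc i\<close> of \<open>q e\<close>.\<close>

definition slots :: "('a + 'a set \<times> nat) set" where
  "slots = Inl ` V \<union> Inr ` (SIGMA e:E. {..<len e})"

fun vert :: "'a + 'a set \<times> nat \<Rightarrow> 'b" where
  "vert (Inl u) = f u"
| "vert (Inr (e, i)) = q e ! Suc i"

fun pos :: "'a + 'a set \<times> nat \<Rightarrow> nat" where
  "pos (Inl u) = num u * 2 ^ m"
| "pos (Inr (e, i)) = num (src e) * 2 ^ m + 2 ^ lev e * (2 * (i - slack e) + 1)"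

text \<open>Orders the vertices piled up at one position along their path.\<close>

fun rank :: "'a + 'a set \<times> nat \<Rightarrow> nat" where
  "rank (Inl u) = 0"
| "rank (Inr (e, i)) = i"

text \<open>A positive height is one more than an exponent of 2 dividing the position, so high
  vertices are confined to coarse multiples.\<close>

fun height :: "'a + 'a set \<times> nat \<Rightarrow> nat" where
  "height (Inl u) = Suc m"
| "height (Inr (e, i)) = (if i = 0 \<or> slack e \<le> i then Suc (lev e) else 0)"

definition key :: "'a + 'a set \<times> nat \<Rightarrow> nat \<times> nat" where
  "key x = (pos x, rank x)"

section \<open>Arithmetic and injectivity of positions\<close>

lemma slot_cases:
  assumes "x \<in> slots"
  obtains u where "x = Inl u" "u \<in> V" | e i where "x = Inr (e, i)" "e \<in> E" "i < len e"
  using assms by (auto simp: slots_def)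

lemma finite_slots: "finite slots"
  using fin by (auto simp: slots_def)

lemma pow_split: "e \<in> E \<Longrightarrow> (2::nat) ^ m = 2 ^ lev e * (2 * 2 ^ (m - Suc (lev e)))"
  using lev(2)[of e] by (simp flip: power_Suc power_add)

lemma steps_pos: "e \<in> E \<Longrightarrow> 0 < steps e"
  using ends(3) by (simp add: steps_def)

text \<open>Here the subdivision length enters: the ends are at most \<open>n\<close> blocks apart,
  so there are enough inner vertices to visit every odd multiple.\<close>

lemma steps_le_len:
  assumes "e \<in> E"
  shows "steps e \<le> len e"
proof -
  have "num (tgt e) - num (src e) \<le> n" using num(2)[OF ends(2)[OF assms]] by simp
  moreover have "(2::nat) ^ (m - Suc (lev e)) \<le> 2 ^ m" by (intro power_increasing) auto
  ultimately have "steps e \<le> n * 2 ^ m" unfolding steps_def by (intro mult_le_mono)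
  then show ?thesis using q(1)[OF assms] by (simp add: len_def)
qed

lemma pos_tgt: "e \<in> E \<Longrightarrow> num (tgt e) * 2 ^ m = num (src e) * 2 ^ m + 2 ^ lev e * (2 * steps e)"
  using ends(3)[of e] pow_split[of e]
  by (simp add: steps_def algebra_simps diff_mult_distrib)

text \<open>The start of a block is a multiple of \<open>2 ^ Suc (lev e)\<close>, so adding it keeps
  the factor odd.\<close>

lemma pos_inner:
  assumes "e \<in> E"
  shows "pos (Inr (e, i)) = 2 ^ lev e * (2 * (num (src e) * 2 ^ (m - Suc (lev e)) + (i - slack e)) + 1)"
  using pow_split[OF assms] by (simp add: algebra_simps)

lemma pos_inner_eq:
  assumes "e \<in> E" "e' \<in> E" "pos (Inr (e, i)) = pos (Inr (e', i'))"
  shows "e = e' \<and> i - slack e = i' - slack e'"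
proof -
  have "lev e = lev e'"
    using assms(3) pow2_odd_unique unfolding pos_inner[OF assms(1)] pos_inner[OF assms(2)] by blast
  then have "e = e'" using lev(1) assms(1,2) by (auto dest: inj_onD)
  with assms(3) show ?thesis by simp
qed

lemma pos_inner_neq:
  assumes "e \<in> E"
  shows "pos (Inl u) \<noteq> pos (Inr (e, i))"
proof
  assume "pos (Inl u) = pos (Inr (e, i))"
  then have "2 ^ lev e * (2 * (num u * 2 ^ (m - Suc (lev e)))) =
      2 ^ lev e * (2 * (num (src e) * 2 ^ (m - Suc (lev e)) + (i - slack e)) + 1)"
    unfolding pos_inner[OF assms] using pow_split[OF assms] by (simp add: algebra_simps)
  then have "2 * (num u * 2 ^ (m - Suc (lev e))) =
      2 * (num (src e) * 2 ^ (m - Suc (lev e)) + (i - slack e)) + 1"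
    unfolding mult_cancel_left by simp
  then show False by presburger
qed

lemma pos_dvd:
  assumes "x \<in> slots" "j \<le> m" "j < height x"
  shows "2 ^ j dvd pos x"
  using assms(1)
proof (cases rule: slot_cases)
  case (1 u)
  then show ?thesis using assms(2) by (simp add: le_imp_power_dvd)
next
  case (2 e i)
  then have "j \<le> lev e" using assms(3) by (simp split: if_splits)
  then show ?thesis unfolding 2(1) pos_inner[OF 2(2)] by (simp add: le_imp_power_dvd dvd_mult2)
qed

text \<open>Only vertices in the pile of one edge share a position, and \<open>rank\<close>
  separates these.\<close>

lemma inj_key: "inj_on key slots"
proof (rule inj_onI)
  fix x y assume xy: "x \<in> slots" "y \<in> slots" and eq: "key x = key y"
  from xy(1) show "x = y"
  proof (cases rule: slot_cases)
    case x: (1 u)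
    from xy(2) show ?thesis
    proof (cases rule: slot_cases)
      case (1 v)
      then show ?thesis using x eq num(1) by (auto simp: key_def dest: inj_onD)
    next
      case (2 e i)
      then show ?thesis using x eq pos_inner_neq[of e u i] by (simp add: key_def)
    qed
  next
    case x: (2 e i)
    from xy(2) show ?thesis
    proof (cases rule: slot_cases)
      case (1 v)
      then have "pos (Inl v) = pos (Inr (e, i))" using x eq by (metis key_def prod.inject)
      then show ?thesis using pos_inner_neq[OF x(2)] by metis
    next
      case (2 e' i')
      then have "pos (Inr (e, i)) = pos (Inr (e', i'))" "i = i'"
        using x eq by (metis key_def prod.inject, simp add: key_def)
      then show ?thesis using x 2 pos_inner_eq by metis
    qed
  qed
qed

text \<open>The flag marks the first vertex of a path. Any other inner vertex of positive height has
  \<open>slack e \<le> i\<close>, so the truncated \<open>i - slack e\<close> determines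
  \<open>i\<close>.\<close>

lemma inj_pos_high:
  "inj_on (\<lambda>x. (pos x, x \<in> Inr ` (E \<times> {0}))) {x \<in> slots. 0 < height x}"
proof (rule inj_onI)
  fix x y assume xy: "x \<in> {x \<in> slots. 0 < height x}" "y \<in> {x \<in> slots. 0 < height x}"
    and eq: "(pos x, x \<in> Inr ` (E \<times> {0})) = (pos y, y \<in> Inr ` (E \<times> {0}))"
  then have "x \<in> slots" "y \<in> slots" by auto
  from this(1) show "x = y"
  proof (cases rule: slot_cases)
    case x: (1 u)
    from \<open>y \<in> slots\<close> show ?thesis
    proof (cases rule: slot_cases)
      case (1 v)
      then show ?thesis using x eq num(1) by (auto dest: inj_onD)
    next
      case (2 e i)
      then show ?thesis using x eq pos_inner_neq[of e u i] by simp
    qed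
  next
    case x: (2 e i)
    from \<open>y \<in> slots\<close> show ?thesis
    proof (cases rule: slot_cases)
      case (1 v)
      then have "pos (Inl v) = pos (Inr (e, i))" using x eq by (metis prod.inject)
      then show ?thesis using pos_inner_neq[OF x(2)] by metis
    next
      case (2 e' i')
      then have "e = e'" "i - slack e = i' - slack e'"
        using x eq pos_inner_eq[of e e' i i'] by auto
      moreover have "i = 0 \<longleftrightarrow> i' = 0" using x 2 eq by (auto simp: image_iff)
      ultimately show ?thesis using xy x 2 by (auto split: if_splits)
    qed
  qed
qed

text \<open>Among the positions, only the three multiples of \<open>2 ^ j\<close> in the window carry vertices of
  height above \<open>j\<close>, and each of them carries at most two.\<close>

lemma few_high:
  assumes "j \<le> m" "2 ^ j dvd a"
  shows "card {x \<in> slots. a \<le> pos x \<and> pos x \<le> a + 2 * 2 ^ j \<and> j < height x} \<le> 6"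
    (is "card ?S \<le> 6")
proof -
  let ?g = "\<lambda>x. (pos x, x \<in> Inr ` (E \<times> {0}))"
  have "?g ` ?S \<subseteq> {a, a + 2 ^ j, a + 2 * 2 ^ j} \<times> UNIV"
  proof (rule image_subsetI)
    fix x assume "x \<in> ?S"
    then have x: "x \<in> slots" "a \<le> pos x" "pos x \<le> a + 2 * 2 ^ j" "j < height x" by auto
    obtain k where k: "pos x = 2 ^ j * k" using pos_dvd[OF x(1) assms(1) x(4)] by auto
    obtain b where b: "a = 2 ^ j * b" using assms(2) by auto
    have "2 ^ j * b \<le> 2 ^ j * k" "2 ^ j * k \<le> 2 ^ j * (b + 2)"
      using x k b by (auto simp: algebra_simps)
    then have "b \<le> k" "k \<le> b + 2" unfolding mult_le_cancel1 by auto
    then have "k = b \<or> k = b + 1 \<or> k = b + 2" by linarith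
    then show "?g x \<in> {a, a + 2 ^ j, a + 2 * 2 ^ j} \<times> UNIV"
      using k b by (auto simp: algebra_simps)
  qed
  moreover have "inj_on ?g ?S" by (rule inj_on_subset[OF inj_pos_high]) auto
  moreover have "card ({a, a + 2 ^ j, a + 2 * 2 ^ j} \<times> (UNIV :: bool set)) \<le> 6"
    by (simp add: card_cartesian_product card_insert_if)
  moreover have "finite ({a, a + 2 ^ j, a + 2 * 2 ^ j} \<times> (UNIV :: bool set))" by simp
  ultimately show ?thesis by (meson card_inj_on_le le_trans)
qed

section \<open>The local height condition along the paths\<close>

definition between :: "'a + 'a set \<times> nat \<Rightarrow> 'a + 'a set \<times> nat \<Rightarrow> ('a + 'a set \<times> nat) set" where
  "between x y = {w \<in> slots. key x \<le> key w \<and> key w \<le> key y \<and> min (height x) (height y) \<le> height w}"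

text \<open>The window of \<open>few_high\<close> starts at \<open>pos x\<close>, a multiple of
  \<open>2 ^ j\<close> by \<open>pos_dvd\<close>.\<close>

lemma card_between_le:
  assumes "j \<le> m" "pos y \<le> pos x + 2 * 2 ^ j"
    and "x \<in> slots" "j < height x" "j < height y"
  shows "card (between x y) \<le> 6"
proof -
  have "between x y \<subseteq> {w \<in> slots. pos x \<le> pos w \<and> pos w \<le> pos x + 2 * 2 ^ j \<and> j < height w}"
    using assms(2,4,5) by (auto simp: between_def key_def less_eq_prod_def)
  then have "card (between x y) \<le> card \<dots>" using finite_slots by (intro card_mono) auto
  also have "\<dots> \<le> 6" using pos_dvd assms(1,3,4) by (intro few_high) auto
  finally show ?thesis .
qed

lemma inj_vert: "inj_on vert slots"
proof (rule inj_onI)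
  have int: "q e ! Suc i \<in> path_interior (q e)" if "i < len e" for e i
    using that by (auto simp: path_interior_conv_nth len_def)
  fix x y assume xy: "x \<in> slots" "y \<in> slots" and eq: "vert x = vert y"
  from xy(1) show "x = y"
  proof (cases rule: slot_cases)
    case x: (1 u)
    from xy(2) show ?thesis
    proof (cases rule: slot_cases)
      case (1 v)
      then show ?thesis using x eq f by (auto dest: inj_onD)
    next
      case (2 e i)
      then show ?thesis using x eq int[of i e] interior(1)[of e] by force
    qed
  next
    case x: (2 e i)
    from xy(2) show ?thesis
    proof (cases rule: slot_cases)
      case (1 v)
      then show ?thesis using x eq int[of i e] interior(1)[of e] by force
    next
      case (2 e' i')
      then have "e = e'" using x eq int[of i e] int[of i' e'] interior(2)[of e e'] by auto
      moreover from this have "i = i'"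
        using x 2 eq q(2)[of e] by (auto simp: len_def nth_eq_iff_index_eq)
      ultimately show ?thesis using x 2 by simp
    qed
  qed
qed

lemma vert_slots: "vert ` slots = f ` V \<union> (\<Union>e\<in>E. path_interior (q e))"
  unfolding slots_def image_Un image_image path_interior_conv_nth len_def by force

text \<open>Outside the pile, both ends of a path edge are higher than \<open>lev e\<close> and at
  most \<open>2 * 2 ^ lev e\<close> apart. Inside the pile, they are consecutive in the
  order.\<close>

lemma edge_between:
  assumes "e \<in> E" "s \<in> path_edges (q e)"
  shows "\<exists>x\<in>slots. \<exists>y\<in>slots. s = {vert x, vert y} \<and> key x \<le> key y \<and> card (between x y) \<le> 6"
proof -
  let ?j = "lev e" and ?r = "slack e" and ?L = "len e"
  note e = assms(1)
  have j: "?j \<le> m" "?j < m" using lev(2)[OF e] by auto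
  have L: "0 < ?L" "?r < ?L" "length (q e) = ?L + 2" "?L - 1 - ?r = steps e - 1"
    using steps_pos[OF e] steps_le_len[OF e] q(1)[OF e] by (auto simp: slack_def len_def)
  have "q e \<noteq> []" using L(3) by auto
  then have first: "q e ! 0 = f (src e)" and final: "q e ! Suc ?L = f (tgt e)"
    using ends(4,5)[OF e] L(3) hd_conv_nth[of "q e"] last_conv_nth[of "q e"] by auto
  obtain i where i: "Suc i < length (q e)" "s = {q e ! i, q e ! Suc i}"
    using assms(2) by (auto simp: path_edges_def)
  have in_slots: "Inl (src e) \<in> slots" "Inl (tgt e) \<in> slots" "\<And>k. k < ?L \<Longrightarrow> Inr (e, k) \<in> slots"
    using e ends by (auto simp: slots_def)
  \<comment> \<open>The cases are the edge at the source, the edge at the target, an edge inside the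
    pile, and an edge between consecutive odd multiples.\<close>
  consider "i = 0" | "i = ?L" | k where "i = Suc k" "Suc k < ?L" "Suc k \<le> ?r"
    | k where "i = Suc k" "Suc k < ?L" "?r < Suc k"
  proof -
    have "i = 0 \<or> i = ?L \<or> (\<exists>k. i = Suc k \<and> Suc k < ?L)"
      using i(1) L(3) by (cases i) auto
    then show thesis using that by (metis not_le)
  qed
  then show ?thesis
  proof cases
    case 1
    have "card (between (Inl (src e)) (Inr (e, 0))) \<le> 6"
      using j L in_slots by (intro card_between_le[of ?j]) auto
    then show ?thesis using 1 i first L in_slots
      by (intro bexI[of _ "Inl (src e)"] bexI[of _ "Inr (e, 0)"]) (auto simp: key_def)
  next
    case 2
    \<comment> \<open>By the choice of \<open>slack\<close>, the last inner vertex sits on the last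
      odd multiple before the target.\<close>
    have p: "pos (Inl (tgt e)) = pos (Inr (e, ?L - 1)) + 2 ^ ?j"
      using pos_tgt[OF e] steps_pos[OF e] L(4)
      by (cases "steps e") (auto simp: algebra_simps)
    have "card (between (Inr (e, ?L - 1)) (Inl (tgt e))) \<le> 6"
      using j L in_slots p
      by (intro card_between_le[of ?j]) (auto simp del: pos.simps(2))
    then show ?thesis using 2 i final L in_slots p
      by (intro bexI[of _ "Inl (tgt e)"] bexI[of _ "Inr (e, ?L - 1)"])
        (auto simp: key_def simp del: pos.simps)
  next
    case (3 k)
    let ?x = "Inr (e, k)" and ?y = "Inr (e, Suc k)"
    \<comment> \<open>Heights may be 0 here, but equal positions and consecutive ranks leave no room
      for a third key.\<close>
    have "key ` between ?x ?y \<subseteq> {key ?x, key ?y}"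
      using 3 by (auto simp: between_def key_def less_eq_prod_def)
    then have "card (key ` between ?x ?y) \<le> card {key ?x, key ?y}" by (intro card_mono) auto
    moreover have "inj_on key (between ?x ?y)"
      using inj_key by (rule inj_on_subset) (auto simp: between_def)
    ultimately have "card (between ?x ?y) \<le> 6"
      using card_image[of key "between ?x ?y"] card_insert_le_m1[of 2 "{key ?y}" "key ?x"] by simp
    then show ?thesis using 3 i in_slots
      by (intro bexI[of _ ?x] bexI[of _ ?y]) (auto simp: key_def)
  next
    case (4 k)
    let ?x = "Inr (e, k)" and ?y = "Inr (e, Suc k)"
    have p: "pos ?y = pos ?x + 2 * 2 ^ ?j"
      using 4 by (simp add: Suc_diff_le algebra_simps)
    have "card (between ?x ?y) \<le> 6"
      using j 4 in_slots p
      by (intro card_between_le[of ?j]) (auto simp del: pos.simps)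
    then show ?thesis using 4 i in_slots p
      by (intro bexI[of _ ?x] bexI[of _ ?y]) (auto simp: key_def simp del: pos.simps)
  qed
qed

text \<open>The constant is \<open>4 * D + 2\<close> with \<open>D = 6\<close>.\<close>

lemma stw_le_26:
  "stw (f ` V \<union> (\<Union>e\<in>E. path_interior (q e))) (\<Union>e\<in>E. path_edges (q e)) \<le> 26"
proof -
  define inv where "inv = inv_into slots vert"
  have inv: "inv (vert x) = x" if "x \<in> slots" for x
    using that inj_vert by (simp add: inv_def)
  have "stw (vert ` slots) (\<Union>e\<in>E. path_edges (q e)) \<le> 4 * 6 + 2"
  proof (rule stw_le_of_local_edges[where key = "key \<circ> inv" and h = "height \<circ> inv"])
    show "finite (vert ` slots)" using finite_slots by simp
    show "inj_on (key \<circ> inv) (vert ` slots)"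
      using inj_key inv by (auto simp: inj_on_def)
    fix s assume "s \<in> (\<Union>e\<in>E. path_edges (q e))"
    then obtain x y where xy: "x \<in> slots" "y \<in> slots" "s = {vert x, vert y}" "key x \<le> key y"
      "card (between x y) \<le> 6" using edge_between by blast
    have "{w \<in> vert ` slots. key x \<le> key (inv w) \<and> key (inv w) \<le> key y
        \<and> min (height x) (height y) \<le> height (inv w)} = vert ` between x y"
      using inv by (auto simp: between_def)
    moreover have "card (vert ` between x y) \<le> 6"
      using xy(5) finite_slots card_image_le[of "between x y" vert]
      by (simp add: between_def)
    ultimately show "\<exists>u\<in>vert ` slots. \<exists>v\<in>vert ` slots. s = {u, v} \<and>
        (key \<circ> inv) u \<le> (key \<circ> inv) v \<and> card {w \<in> vert ` slots.
          (key \<circ> inv) u \<le> (key \<circ> inv) w \<and> (key \<circ> inv) w \<le> (key \<circ> inv) v \<and>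
          min ((height \<circ> inv) u) ((height \<circ> inv) v) \<le> (height \<circ> inv) w} \<le> 6"
      using xy inv by (intro bexI[of _ "vert x"] bexI[of _ "vert y"]) auto
  qed
  then show ?thesis by (simp add: vert_slots)
qed

end

section \<open>Orienting the paths and the final estimate\<close>

theorem theorem6:
  fixes V :: "'a set" and E :: "'a set set"
    and V' :: "'b set" and E' :: "'b set set"
    and n m d :: nat
  assumes "simple_graph V E"
    and "card V = n" and "card E = m" and "max_degree V E = d"
    and "is_ge_subdivision (n * 2 ^ m) V E V' E'"
  shows "stw V' E' \<le> 32 * (4 * d + 5) ^ 3"
proof -
  have fin: "finite V" "finite E" and E: "\<And>e. e \<in> E \<Longrightarrow> e \<subseteq> V \<and> card e = 2"
    using assms(1) finite_subset[of E "Pow V"] by (auto simp: simple_graph_def)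
  obtain num where num: "bij_betw num V {0..<n}"
    using ex_bij_betw_finite_nat[OF fin(1)] assms(2) by auto
  obtain lev where lev: "bij_betw lev E {0..<m}"
    using ex_bij_betw_finite_nat[OF fin(2)] assms(3) by auto
  obtain f p where f: "inj_on f V"
    and p: "\<And>e. e \<in> E \<Longrightarrow> n * 2 ^ m + 2 \<le> length (p e) \<and> distinct (p e) \<and>
      {hd (p e), last (p e)} = f ` e \<and> path_interior (p e) \<inter> f ` V = {}"
    and dj: "\<And>e e'. \<lbrakk>e \<in> E; e' \<in> E; e \<noteq> e'\<rbrakk> \<Longrightarrow> path_interior (p e) \<inter> path_interior (p e') = {}"
    and V': "V' = f ` V \<union> (\<Union>e\<in>E. path_interior (p e))"
    and E': "E' = (\<Union>e\<in>E. path_edges (p e))"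
    using assms(5) unfolding is_ge_subdivision_def
    by (elim exE conjE) (rule that, auto)
  \<comment> \<open>Each path is reversed if necessary so that it runs from the lower to the higher
    numbered end.\<close>
  have "\<exists>xs u v. (xs = p e \<or> xs = rev (p e)) \<and> u \<in> V \<and> v \<in> V \<and> num u < num v \<and>
      hd xs = f u \<and> last xs = f v" if e: "e \<in> E" for e
  proof -
    have ne: "p e \<noteq> []" using p[OF e] by auto
    obtain a b where ab: "e = {a, b}" "a \<noteq> b" "a \<in> V" "b \<in> V"
      using E[OF e] by (auto simp: card_2_iff)
    have "{hd (p e), last (p e)} = {f a, f b}" using p[OF e] ab(1) by auto
    then have "\<exists>u\<in>V. \<exists>v\<in>V. u \<noteq> v \<and> hd (p e) = f u \<and> last (p e) = f v"
      using ab by (metis doubleton_eq_iff)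
    then obtain u v where uv: "u \<in> V" "v \<in> V" "u \<noteq> v" "hd (p e) = f u" "last (p e) = f v"
      by blast
    have "num u \<noteq> num v" using uv num by (auto simp: bij_betw_def dest: inj_onD)
    then consider "num u < num v" | "num v < num u" by linarith
    then show ?thesis
    proof cases
      case 1
      then show ?thesis using uv by (intro exI[of _ "p e"] exI[of _ u] exI[of _ v]) simp
    next
      case 2
      then show ?thesis using uv ne
        by (intro exI[of _ "rev (p e)"] exI[of _ v] exI[of _ u]) (simp add: hd_rev last_rev)
    qed
  qed
  then obtain q src tgt where q: "\<And>e. e \<in> E \<Longrightarrow> (q e = p e \<or> q e = rev (p e)) \<and> src e \<in> V \<and>
      tgt e \<in> V \<and> num (src e) < num (tgt e) \<and> hd (q e) = f (src e) \<and> last (q e) = f (tgt e)"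
    by metis
  have qp: "length (q e) = length (p e)" "distinct (q e) = distinct (p e)"
    "path_interior (q e) = path_interior (p e)" "path_edges (q e) = path_edges (p e)"
    if "e \<in> E" for e
    using q[OF that] by (auto simp: path_interior_rev path_edges_rev)
  interpret oriented_subdivision V E n m num lev f q src tgt
  proof
    show "inj_on num V" "inj_on lev E" using num lev by (auto simp: bij_betw_def)
    show "num v < n" if "v \<in> V" for v using that num by (auto simp: bij_betw_def)
    show "lev e < m" if "e \<in> E" for e using that lev by (auto simp: bij_betw_def)
  qed (use fin f p q qp dj in auto)
  have "stw V' E' \<le> 26"
    using stw_le_26 qp unfolding V' E' by simp
  \<comment> \<open>The absolute bound is below the value at \<open>d = 0\<close>, and the
    right-hand side grows with \<open>d\<close>.\<close>
  also have "26 \<le> 32 * (5::nat) ^ 3" by simp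
  also have "\<dots> \<le> 32 * (4 * d + 5) ^ 3" by (intro mult_le_mono power_mono) auto
  finally show ?thesis .
qed

end
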